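(* Let $G=(V,w,m)$ be a graph and let $x\neq y$ be vertices. Then $$\kappa(x,y)=\inf_{\substack{f\in Lip(1)\cap C_c(V)\\ \nabla_{yx}f=1}}\nabla_{xy}\Delta f .$$
   Context: A graph is a triple $G=(V,w,m)$ with $V$ a countable set, $w:V\times V\to[0,\infty)$ symmetric and zero on the diagonal, and $m:V\to(0,\infty)$. Write $x\sim y$ if $w(x,y)>0$. All graphs are locally finite (for each $x$ only finitely many $y$ satisfy $x\sim y$) and connected; $d(x,y)=\inf\{n: x=x_0\sim\cdots\sim x_n=y\}$ is the combinatorial distance, which is finite by connectedness. The Laplacian is $\Delta f(x)=\frac1{m(x)}\sum_{y\in V}w(x,y)(f(y)-f(x))$ for $f:V\to\mathbb R$, and $\mathrm{Deg}(x)=\frac1{m(x)}\sum_{y}w(x,y)$. $C_c(V)$ is the set of finitely supported functions $V\to\mathbb R$. For $x\ne y$, $\nabla_{xy}f=\frac{f(x)-f(y)}{d(x,y)}$. $Lip(1)$ is the set of $f:V\to\mathbb R$ with $|f(x)-f(y)|\le d(x,y)$ for all $x,y$. Curvature: for $x\in V$ and $\varepsilon>0$ let $m_x^\varepsilon(x)=1-\varepsilon\,\mathrm{Deg}(x)$ and $m_x^\varepsilon(y)=\varepsilon w(x,y)/m(x)$ for $y\neq x$; this is a finitely supported probability measure for $\varepsilon$ small. For probability measures $\mu,\nu$ on $V$, $W(\mu,\nu)=\sup_{f}\sum_{x}f(x)(\mu(x)-\nu(x))$, the supremum over bounded $f\in Lip(1)$. For $x\neq y$ let $\kappa_\varepsilon(x,y)=1-\frac{W(m_x^\varepsilon,m_y^\varepsilon)}{d(x,y)}$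 and $\kappa(x,y)=\lim_{\varepsilon\to0^+}\frac1\varepsilon\kappa_\varepsilon(x,y)$ (this limit exists). *)

theory Defs
  imports "HOL-Analysis.Analysis"
begin

text \<open>
  The vertex set is the (countable) universe of the type \<open>'v\<close>.
\<close>

definition adj :: "('v \<Rightarrow> 'v \<Rightarrow> real) \<Rightarrow> 'v \<Rightarrow> 'v \<Rightarrow> bool" where
  "adj w x y \<longleftrightarrow> w x y > 0"

locale weighted_graph =
  fixes w :: "'v \<Rightarrow> 'v \<Rightarrow> real" and m :: "'v \<Rightarrow> real"
  assumes countable_vertices: "countable (UNIV :: 'v set)"
    and w_nonneg: "w x y \<ge> 0"
    and w_sym: "w x y = w y x"
    and w_diag: "w x x = 0"
    and m_pos: "m x > 0"
    and locally_finite: "finite {y. adj w x y}"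
    and connected: "(adj w)\<^sup>*\<^sup>* x y"

definition gdist :: "('v \<Rightarrow> 'v \<Rightarrow> real) \<Rightarrow> 'v \<Rightarrow> 'v \<Rightarrow> nat" where
  "gdist w x y = Inf {n. (adj w ^^ n) x y}"

definition laplacian ::
    "('v \<Rightarrow> 'v \<Rightarrow> real) \<Rightarrow> ('v \<Rightarrow> real) \<Rightarrow> ('v \<Rightarrow> real) \<Rightarrow> 'v \<Rightarrow> real" where
  "laplacian w m f x = (1 / m x) * (\<Sum>\<^sub>\<infinity>y. w x y * (f y - f x))"

definition Deg :: "('v \<Rightarrow> 'v \<Rightarrow> real) \<Rightarrow> ('v \<Rightarrow> real) \<Rightarrow> 'v \<Rightarrow> real" where
  "Deg w m x = (1 / m x) * (\<Sum>\<^sub>\<infinity>y. w x y)"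

definition Cc :: "('v \<Rightarrow> real) set" where
  "Cc = {f. finite {x. f x \<noteq> 0}}"

definition nabla :: "('v \<Rightarrow> 'v \<Rightarrow> real) \<Rightarrow> 'v \<Rightarrow> 'v \<Rightarrow> ('v \<Rightarrow> real) \<Rightarrow> real" where
  "nabla w x y f = (f x - f y) / real (gdist w x y)"

definition Lip1 :: "('v \<Rightarrow> 'v \<Rightarrow> real) \<Rightarrow> ('v \<Rightarrow> real) set" where
  "Lip1 w = {f. \<forall>x y. \<bar>f x - f y\<bar> \<le> real (gdist w x y)}"

text \<open>
  Measures on the vertices are given by their mass functions.  For large \<open>\<epsilon>\<close>
  the function below takes a negative value at \<open>x\<close>; only the limit
  \<open>\<epsilon> \<rightarrow> 0+\<close> is used.
\<close>

definition walk_measure ::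
    "('v \<Rightarrow> 'v \<Rightarrow> real) \<Rightarrow> ('v \<Rightarrow> real) \<Rightarrow> real \<Rightarrow> 'v \<Rightarrow> 'v \<Rightarrow> real" where
  "walk_measure w m \<epsilon> x y =
     (if y = x then 1 - \<epsilon> * Deg w m x else \<epsilon> * w x y / m x)"

text \<open>
  The supremum is taken in the reals, hence meaningful only if it is finite.
  For the walk measures it is, see \<open>Wasserstein_bdd_above\<close> below.
\<close>

definition Wasserstein ::
    "('v \<Rightarrow> 'v \<Rightarrow> real) \<Rightarrow> ('v \<Rightarrow> real) \<Rightarrow> ('v \<Rightarrow> real) \<Rightarrow> real" where
  "Wasserstein w \<mu> \<nu> =
     (SUP f\<in>{f \<in> Lip1 w. bounded (range f)}. \<Sum>\<^sub>\<infinity>x. f x * (\<mu> x - \<nu> x))"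

definition kappa_eps ::
    "('v \<Rightarrow> 'v \<Rightarrow> real) \<Rightarrow> ('v \<Rightarrow> real) \<Rightarrow> real \<Rightarrow> 'v \<Rightarrow> 'v \<Rightarrow> real" where
  "kappa_eps w m \<epsilon> x y =
     1 - Wasserstein w (walk_measure w m \<epsilon> x) (walk_measure w m \<epsilon> y) / real (gdist w x y)"

definition kappa ::
    "('v \<Rightarrow> 'v \<Rightarrow> real) \<Rightarrow> ('v \<Rightarrow> real) \<Rightarrow> 'v \<Rightarrow> 'v \<Rightarrow> real" where
  "kappa w m x y = Lim (at_right 0) (\<lambda>\<epsilon>. (1 / \<epsilon>) * kappa_eps w m \<epsilon> x y)"

text \<open>
  The real suprema and infima that occur are over nonempty bounded sets.
\<close>

context weighted_graph
begin

lemma gdist_relpowp: "(adj w ^^ gdist w x y) x y"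
proof -
  obtain n where "(adj w ^^ n) x y"
    using connected[of x y] by (metis rtranclp_imp_relpowp)
  then have "{n. (adj w ^^ n) x y} \<noteq> {}" by blast
  from Inf_nat_def1[OF this] show ?thesis by (simp add: gdist_def)
qed

lemma gdist_le: "(adj w ^^ n) x y \<Longrightarrow> gdist w x y \<le> n"
  unfolding gdist_def by (rule wellorder_Inf_le1) simp

lemma gdist_triangle: "gdist w x z \<le> gdist w x y + gdist w y z"
  by (intro gdist_le) (use gdist_relpowp relpowp_trans in metis)

lemma relpowp_adj_sym: "(adj w ^^ n) x y \<Longrightarrow> (adj w ^^ n) y x"
proof (induction n arbitrary: y)
  case (Suc n)
  then obtain z where z: "(adj w ^^ n) x z" "adj w z y" by auto
  then have "adj w y z" by (simp add: adj_def w_sym)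
  with Suc.IH[OF z(1)] show ?case by (meson relpowp_Suc_I2)
qed simp

lemma gdist_sym: "gdist w x y = gdist w y x"
  by (meson antisym gdist_le gdist_relpowp relpowp_adj_sym)

lemma gdist_self: "gdist w x x = 0"
  using gdist_le[of 0 x x] by simp

lemma gdist_pos: "x \<noteq> y \<Longrightarrow> gdist w x y > 0"
  using gdist_relpowp[of x y] by (cases "gdist w x y") auto

lemma gdist_adj: "adj w x y \<Longrightarrow> gdist w x y \<le> 1"
  by (rule gdist_le) auto

lemma finite_relpowp: "finite {y. (adj w ^^ n) x y}"
proof (induction n)
  case (Suc n)
  have "{y. (adj w ^^ Suc n) x y} = (\<Union>z\<in>{z. (adj w ^^ n) x z}. {y. adj w z y})"
    by auto
  then show ?case using Suc locally_finite by simp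
qed simp

lemma finite_ball: "finite {y. gdist w x y \<le> n}"
proof -
  have "{y. gdist w x y \<le> n} \<subseteq> (\<Union>k\<in>{..n}. {y. (adj w ^^ k) x y})"
    using gdist_relpowp by force
  then show ?thesis by (rule finite_subset) (simp add: finite_relpowp)
qed

lemma w_eq_0: "\<not> adj w x y \<Longrightarrow> w x y = 0"
  using w_nonneg[of x y] by (simp add: adj_def)

lemma infsum_w: "(\<Sum>\<^sub>\<infinity>y. w x y * g y) = (\<Sum>y | adj w x y. w x y * g y)"
proof -
  have "(\<Sum>\<^sub>\<infinity>y. w x y * g y) = (\<Sum>\<^sub>\<infinity>y\<in>{y. adj w x y}. w x y * g y)"
    by (rule infsum_cong_neutral) (auto simp: w_eq_0)
  then show ?thesis by (simp add: locally_finite)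
qed

lemma Deg_sum: "Deg w m x = (1 / m x) * (\<Sum>y | adj w x y. w x y)"
  using infsum_w[of x "\<lambda>_. 1"] by (simp add: Deg_def)

lemma laplacian_abs_le:
  assumes "f \<in> Lip1 w"
  shows "\<bar>laplacian w m f x\<bar> \<le> Deg w m x"
proof -
  have "\<bar>\<Sum>y | adj w x y. w x y * (f y - f x)\<bar> \<le> (\<Sum>y | adj w x y. w x y)"
  proof (rule order_trans[OF sum_abs sum_mono])
    fix y assume y: "y \<in> {y. adj w x y}"
    have "\<bar>f y - f x\<bar> \<le> real (gdist w y x)" using assms by (simp add: Lip1_def)
    also have "\<dots> \<le> 1" using gdist_adj[of x y] y by (simp add: gdist_sym)
    finally show "\<bar>w x y * (f y - f x)\<bar> \<le> w x y"
      using w_nonneg[of x y] by (simp add: abs_mult mult_left_le)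
  qed
  then show ?thesis
    using m_pos[of x] by (simp add: laplacian_def Deg_sum infsum_w abs_mult divide_right_mono)
qed

lemma admissible_bdd_below:
  "bdd_below ((\<lambda>f. nabla w x y (laplacian w m f)) ` {f \<in> Lip1 w \<inter> Cc. nabla w y x f = 1})"
proof (rule bdd_belowI2)
  fix f assume "f \<in> {f \<in> Lip1 w \<inter> Cc. nabla w y x f = 1}"
  then have "laplacian w m f x - laplacian w m f y \<ge> - (Deg w m x + Deg w m y)"
    using laplacian_abs_le[of f x] laplacian_abs_le[of f y] by auto
  then show "- (Deg w m x + Deg w m y) / real (gdist w x y) \<le> nabla w x y (laplacian w m f)"
    unfolding nabla_def by (intro divide_right_mono) auto
qed

lemma admissible_nonempty:
  assumes "x \<noteq> y"
  shows "{f \<in> Lip1 w \<inter> Cc. nabla w y x f = 1} \<noteq> {}"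
proof -
  define f where "f z = max 0 (real (gdist w y x) - real (gdist w y z))" for z
  have "f \<in> Lip1 w"
  proof -
    have "\<bar>f u - f v\<bar> \<le> real (gdist w u v)" for u v
      using gdist_triangle[of y u v] gdist_triangle[of y v u] gdist_sym[of u v]
      unfolding f_def by linarith
    then show ?thesis by (simp add: Lip1_def)
  qed
  moreover have "f \<in> Cc"
    unfolding Cc_def
    by (auto intro: finite_subset[OF _ finite_ball[of y "gdist w y x"]] simp: f_def max_def)
  moreover have "nabla w y x f = 1"
    using gdist_pos[of y x] assms by (simp add: nabla_def f_def gdist_self)
  ultimately show ?thesis by blast
qed

lemma walk_measure_eq_0: "z \<noteq> x \<Longrightarrow> \<not> adj w x z \<Longrightarrow> walk_measure w m \<epsilon> x z = 0"
  by (simp add: walk_measure_def w_eq_0)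

lemma sum_walk_measure:
  assumes "finite A" "insert x {z. adj w x z} \<subseteq> A"
  shows "(\<Sum>z\<in>A. walk_measure w m \<epsilon> x z) = 1"
proof -
  have x: "x \<notin> {z. adj w x z}" by (simp add: adj_def w_diag)
  have "(\<Sum>z\<in>A. walk_measure w m \<epsilon> x z)
      = (\<Sum>z\<in>insert x {z. adj w x z}. walk_measure w m \<epsilon> x z)"
    using assms by (intro sum.mono_neutral_right) (auto intro: walk_measure_eq_0)
  also have "\<dots> = 1 - \<epsilon> * Deg w m x + (\<Sum>z | adj w x z. walk_measure w m \<epsilon> x z)"
    using x locally_finite by (simp add: walk_measure_def)
  also have "(\<Sum>z | adj w x z. walk_measure w m \<epsilon> x z) = (\<Sum>z | adj w x z. \<epsilon> * w x z / m x)"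
    using x by (intro sum.cong) (auto simp: walk_measure_def)
  also have "\<dots> = \<epsilon> * Deg w m x"
    by (simp add: Deg_sum sum_distrib_left sum_divide_distrib)
  finally show ?thesis by simp
qed

lemma Wasserstein_bdd_above:
  "bdd_above ((\<lambda>f. \<Sum>\<^sub>\<infinity>z. f z * (walk_measure w m \<epsilon> x z - walk_measure w m \<epsilon> y z))
     ` {f \<in> Lip1 w. bounded (range f)})"
proof -
  define A where "A = insert x {z. adj w x z} \<union> insert y {z. adj w y z}"
  define d where "d z = walk_measure w m \<epsilon> x z - walk_measure w m \<epsilon> y z" for z
  have A: "finite A" using locally_finite by (simp add: A_def)
  have d0: "d z = 0" if "z \<notin> A" for z
    using that walk_measure_eq_0 by (auto simp: A_def d_def)
  have "(\<Sum>z\<in>A. d z) = 0"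
  proof -
    have "insert x {z. adj w x z} \<subseteq> A" "insert y {z. adj w y z} \<subseteq> A"
      by (auto simp: A_def)
    then show ?thesis by (simp add: d_def sum_subtractf sum_walk_measure A)
  qed
  have "(\<Sum>\<^sub>\<infinity>z. f z * d z) \<le> (\<Sum>z\<in>A. real (gdist w z x) * \<bar>d z\<bar>)" if f: "f \<in> Lip1 w" for f
  proof -
    have "(\<Sum>\<^sub>\<infinity>z. f z * d z) = (\<Sum>\<^sub>\<infinity>z\<in>A. f z * d z)"
      by (rule infsum_cong_neutral) (auto simp: d0)
    also have "\<dots> = (\<Sum>z\<in>A. f z * d z) - f x * (\<Sum>z\<in>A. d z)"
      using A \<open>(\<Sum>z\<in>A. d z) = 0\<close> by simp
    also have "\<dots> = (\<Sum>z\<in>A. (f z - f x) * d z)"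
      by (simp add: left_diff_distrib sum_subtractf sum_distrib_left)
    also have "\<dots> \<le> (\<Sum>z\<in>A. real (gdist w z x) * \<bar>d z\<bar>)"
    proof (rule sum_mono)
      fix z
      have "(f z - f x) * d z \<le> \<bar>f z - f x\<bar> * \<bar>d z\<bar>"
        by (metis abs_ge_self abs_mult)
      also have "\<dots> \<le> real (gdist w z x) * \<bar>d z\<bar>"
        using f by (intro mult_right_mono) (auto simp: Lip1_def)
      finally show "(f z - f x) * d z \<le> real (gdist w z x) * \<bar>d z\<bar>" .
    qed
    finally show ?thesis .
  qed
  then show ?thesis unfolding d_def by (intro bdd_aboveI2) auto
qed

end

end

theory Submission
  imports Defs
begin

text \<open>
  For a Lipschitz function \<open>f\<close> with mean \<open>f x + \<epsilon> \<Delta> f x\<close> under the walk measure at \<open>x\<close>,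
  duality gives \<open>\<kappa>\<^sub>\<epsilon>(x,y) = inf\<^sub>f (1 - \<nabla>\<^sub>y\<^sub>x f + \<epsilon> \<nabla>\<^sub>x\<^sub>y \<Delta> f)\<close>.
  Functions with \<open>\<nabla>\<^sub>y\<^sub>x f = 1\<close> show that \<open>\<kappa>\<^sub>\<epsilon>/\<epsilon>\<close> is at most the infimum of the theorem.
  Conversely, if \<open>f x = 0\<close> and \<open>f y = d(x,y) - \<delta>\<close>, then \<open>min (f + \<delta>) d(x,\<cdot>)\<close> is Lipschitz, has gradient
  \<open>1\<close> and lies between \<open>f\<close> and \<open>f + \<delta>\<close>; passing to it changes \<open>\<nabla>\<^sub>x\<^sub>y \<Delta> f\<close> by \<open>O(\<delta>)\<close>,
  which for small \<open>\<epsilon>\<close> is outweighed by the gain \<open>\<delta> / (\<epsilon> d(x,y))\<close>. Hence \<open>\<kappa>\<^sub>\<epsilon>/\<epsilon>\<close> is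
  constant for small \<open>\<epsilon>\<close>.
\<close>

context weighted_graph
begin

section \<open>Closure properties of Lipschitz and finitely supported functions\<close>

lemma Lip1I:
  assumes "\<And>u v. f u - f v \<le> real (gdist w u v)"
  shows "f \<in> Lip1 w"
proof -
  have "\<bar>f u - f v\<bar> \<le> real (gdist w u v)" for u v
    using assms[of u v] assms[of v u] gdist_sym[of u v] by linarith
  then show ?thesis by (simp add: Lip1_def)
qed

lemma Lip1D: "f \<in> Lip1 w \<Longrightarrow> f u - f v \<le> real (gdist w u v)"
  by (simp add: Lip1_def abs_le_iff)

lemma Lip1_uminus: "f \<in> Lip1 w \<Longrightarrow> (\<lambda>z. - f z) \<in> Lip1 w"
  by (rule Lip1I) (use Lip1D gdist_sym in \<open>metis add.commute diff_conv_add_uminus minus_minus\<close>)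

lemma Lip1_add_const: "f \<in> Lip1 w \<Longrightarrow> (\<lambda>z. f z + c) \<in> Lip1 w"
  by (simp add: Lip1_def)

lemma Lip1_min:
  assumes "f \<in> Lip1 w" "g \<in> Lip1 w"
  shows "(\<lambda>z. min (f z) (g z)) \<in> Lip1 w"
proof (rule Lip1I)
  fix u v
  show "min (f u) (g u) - min (f v) (g v) \<le> real (gdist w u v)"
    using Lip1D[OF assms(1), of u v] Lip1D[OF assms(2), of u v] by linarith
qed

lemma Lip1_max:
  assumes "f \<in> Lip1 w" "g \<in> Lip1 w"
  shows "(\<lambda>z. max (f z) (g z)) \<in> Lip1 w"
proof (rule Lip1I)
  fix u v
  show "max (f u) (g u) - max (f v) (g v) \<le> real (gdist w u v)"
    using Lip1D[OF assms(1), of u v] Lip1D[OF assms(2), of u v] by linarith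
qed

lemma Lip1_gdist: "(\<lambda>z. real (gdist w x z)) \<in> Lip1 w"
proof (rule Lip1I)
  fix u v
  show "real (gdist w x u) - real (gdist w x v) \<le> real (gdist w u v)"
    using gdist_triangle[of x u v] gdist_sym[of u v] by linarith
qed

lemma Cc_bounded: "f \<in> Cc \<Longrightarrow> bounded (range f)"
proof -
  assume "f \<in> Cc"
  then have "finite (insert 0 (f ` {z. f z \<noteq> 0}))" by (simp add: Cc_def)
  then have "finite (range f)" by (rule rev_finite_subset) auto
  then show ?thesis by (rule finite_imp_bounded)
qed

lemma Cc_uminus: "f \<in> Cc \<Longrightarrow> (\<lambda>z. - f z) \<in> Cc"
  by (simp add: Cc_def)

section \<open>The Laplacian and its relation to the walk measures\<close>

lemma laplacian_sum: "laplacian w m f x = (1 / m x) * (\<Sum>y | adj w x y. w x y * (f y - f x))"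
  by (simp add: laplacian_def infsum_w)

lemma laplacian_uminus: "laplacian w m (\<lambda>z. - f z) x = - laplacian w m f x"
proof -
  have "(\<Sum>y | adj w x y. w x y * (- f y - - f x)) = - (\<Sum>y | adj w x y. w x y * (f y - f x))"
    by (simp add: sum_negf[symmetric] algebra_simps)
  then show ?thesis by (simp add: laplacian_sum)
qed

text \<open>The Laplacian depends only on edge increments at \<open>x\<close>, whose normalized
  weights add up to \<open>Deg w m x\<close>. This prices the replacement of one test function by
  another.\<close>

lemma laplacian_diff_abs_le:
  assumes "\<And>y. adj w x y \<Longrightarrow> \<bar>(f y - f x) - (g y - g x)\<bar> \<le> c"
  shows "\<bar>laplacian w m f x - laplacian w m g x\<bar> \<le> c * Deg w m x"
proof -
  have "\<bar>\<Sum>y | adj w x y. w x y * ((f y - f x) - (g y - g x))\<bar> \<le> (\<Sum>y | adj w x y. w x y * c)"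
  proof (rule order_trans[OF sum_abs sum_mono])
    fix y assume "y \<in> {y. adj w x y}"
    then show "\<bar>w x y * ((f y - f x) - (g y - g x))\<bar> \<le> w x y * c"
      using assms w_nonneg[of x y] by (simp add: abs_mult mult_left_mono)
  qed
  moreover have "laplacian w m f x - laplacian w m g x
      = (1 / m x) * (\<Sum>y | adj w x y. w x y * ((f y - f x) - (g y - g x)))"
    by (simp add: laplacian_sum sum_subtractf right_diff_distrib diff_divide_distrib)
  moreover have "c * Deg w m x = (1 / m x) * (\<Sum>y | adj w x y. w x y * c)"
    unfolding Deg_sum sum_distrib_right[symmetric] by simp
  ultimately show ?thesis
    using m_pos[of x] by (simp add: abs_mult divide_right_mono)
qed

lemma Deg_nonneg: "Deg w m x \<ge> 0"
  using m_pos[of x] by (simp add: Deg_sum sum_nonneg w_nonneg)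

text \<open>The mass \<open>\<epsilon> * Deg w m x\<close> removed from \<open>x\<close> is spread
  over its neighbours: an explicit Euler step of the Laplacian. Hence transport functionals are
  exactly affine in \<open>\<epsilon>\<close>.\<close>

lemma has_sum_walk_measure:
  "((\<lambda>z. f z * walk_measure w m \<epsilon> x z) has_sum (f x + \<epsilon> * laplacian w m f x)) UNIV"
proof -
  let ?N = "{z. adj w x z}"
  have x: "x \<notin> ?N" by (simp add: adj_def w_diag)
  have "(\<Sum>z\<in>insert x ?N. f z * walk_measure w m \<epsilon> x z)
      = f x * (1 - \<epsilon> * Deg w m x) + (\<Sum>z\<in>?N. f z * walk_measure w m \<epsilon> x z)"
    using x locally_finite by (simp add: walk_measure_def)
  also have "(\<Sum>z\<in>?N. f z * walk_measure w m \<epsilon> x z) = (\<Sum>z\<in>?N. \<epsilon> / m x * (w x z * f z))"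
    using x by (intro sum.cong) (auto simp: walk_measure_def)
  also have "\<dots> = \<epsilon> / m x * (\<Sum>z\<in>?N. w x z * f z)"
    by (rule sum_distrib_left[symmetric])
  also have "f x * (1 - \<epsilon> * Deg w m x) + \<dots> = f x + \<epsilon> * laplacian w m f x"
    by (simp add: laplacian_sum Deg_sum right_diff_distrib sum_subtractf
        sum_distrib_right[symmetric] diff_divide_distrib)
  finally have "((\<lambda>z. f z * walk_measure w m \<epsilon> x z) has_sum (f x + \<epsilon> * laplacian w m f x))
      (insert x ?N)"
    using has_sum_finite[of "insert x ?N" "\<lambda>z. f z * walk_measure w m \<epsilon> x z"] locally_finite
    by simp
  then show ?thesis
    by (rule has_sum_cong_neutral[THEN iffD1, rotated -1]) (auto intro: walk_measure_eq_0)
qed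

lemma infsum_walk_measure_diff:
  "(\<Sum>\<^sub>\<infinity>z. f z * (walk_measure w m \<epsilon> x z - walk_measure w m \<epsilon> y z))
    = (f x + \<epsilon> * laplacian w m f x) - (f y + \<epsilon> * laplacian w m f y)"
  using infsumI[OF has_sum_add[OF has_sum_walk_measure[of f \<epsilon> x]
        has_sum_uminusI[OF has_sum_walk_measure[of f \<epsilon> y]]]]
  by (simp add: right_diff_distrib)

section \<open>Passing to admissible test functions\<close>

lemma admissible_approximation:
  assumes f: "f \<in> Lip1 w" and "x \<noteq> y"
  defines "\<delta> \<equiv> real (gdist w x y) - (f y - f x)"
  obtains h where "h \<in> Lip1 w \<inter> Cc" "nabla w y x h = 1"
    and "\<And>z. gdist w x z \<le> Suc (gdist w x y) \<Longrightarrow>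
            f z - f x \<le> h z \<and> h z \<le> f z - f x + \<delta>"
proof -
  \<comment> \<open>The ball of radius \<open>R\<close> about \<open>x\<close> contains
    \<open>x\<close>, \<open>y\<close> and all their neighbours, hence everything the two Laplacians
    see.\<close>
  define R where "R = real (gdist w x y) + 1"
  \<comment> \<open>The shift by \<open>\<delta>\<close> lifts the value at \<open>y\<close> to the
    distance; the cap by the distance cone resets the value at \<open>x\<close> to 0.\<close>
  define g where "g z = min (f z + (\<delta> - f x)) (real (gdist w x z))" for z
  \<comment> \<open>Clamping \<open>g\<close> to \<open>[-c, c]\<close> makes the support finite.
    The height \<open>2 * R\<close> keeps \<open>c\<close> at least \<open>R\<close> on the ball of
    radius \<open>R\<close>, where \<open>g\<close> is at most \<open>R\<close> in modulus, so
    nothing changes there.\<close>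
  define c where "c z = max (- real (gdist w x z) + 2 * R) 0" for z
  define h where "h z = max (min (g z) (c z)) (- c z)" for z
  have \<delta>: "\<delta> \<ge> 0" using Lip1D[OF f, of y x] gdist_sym[of x y] by (simp add: \<delta>_def)
  have g_Lip: "g \<in> Lip1 w"
    unfolding g_def by (intro Lip1_min Lip1_add_const Lip1_gdist f)
  have const: "(\<lambda>z. 0) \<in> Lip1 w" by (rule Lip1I) simp
  have c_Lip: "c \<in> Lip1 w"
    unfolding c_def
    by (intro Lip1_max Lip1_add_const Lip1_uminus Lip1_gdist const)
  have gx: "g x = 0" and gy: "g y = real (gdist w x y)"
    using \<delta> by (simp_all add: g_def gdist_self \<delta>_def)
  have h_eq: "h z = g z" if "gdist w x z \<le> Suc (gdist w x y)" for z
  proof -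
    have "\<bar>g z\<bar> \<le> real (gdist w x z)"
      using Lip1D[OF g_Lip, of z x] Lip1D[OF g_Lip, of x z] gx gdist_sym[of x z] by simp
    moreover have "real (gdist w x z) \<le> R" using that by (simp add: R_def)
    ultimately show ?thesis unfolding h_def c_def by linarith
  qed
  show thesis
  proof
    have "h \<in> Lip1 w"
      unfolding h_def by (intro Lip1_max Lip1_min Lip1_uminus g_Lip c_Lip)
    moreover have "{z. h z \<noteq> 0} \<subseteq> {z. gdist w x z \<le> 2 * Suc (gdist w x y)}"
      by (auto simp: h_def c_def R_def)
    then have "h \<in> Cc"
      unfolding Cc_def using finite_ball finite_subset by blast
    ultimately show "h \<in> Lip1 w \<inter> Cc" by simp
    show "nabla w y x h = 1"
      using \<open>x \<noteq> y\<close> gdist_pos[of x y] gdist_sym[of x y] gdist_self[of x]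
      by (simp add: nabla_def h_eq gx gy)
    fix z assume "gdist w x z \<le> Suc (gdist w x y)"
    moreover have "f z - f x \<le> real (gdist w x z)"
      using Lip1D[OF f, of z x] gdist_sym[of x z] by simp
    ultimately show "f z - f x \<le> h z \<and> h z \<le> f z - f x + \<delta>"
      using \<delta> by (auto simp: h_eq g_def)
  qed
qed

abbreviation (input) min_gradient :: "'v \<Rightarrow> 'v \<Rightarrow> real" where
  "min_gradient x y \<equiv>
    (INF f\<in>{f \<in> Lip1 w \<inter> Cc. nabla w y x f = 1}. nabla w x y (laplacian w m f))"

text \<open>The right-hand side is \<open>1\<close> minus the normalized transport functional of
  \<open>-f\<close>. Replacing \<open>f\<close> by an admissible \<open>h\<close> gains the gradient
  deficit and alters the Laplacian term by no more than that gain.\<close>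

lemma transport_cost_lower_bound:
  assumes f: "f \<in> Lip1 w" and "x \<noteq> y"
    and \<epsilon>: "0 \<le> \<epsilon>" "\<epsilon> * (Deg w m x + Deg w m y) \<le> 1"
  shows "\<epsilon> * min_gradient x y \<le> 1 - nabla w y x f + \<epsilon> * nabla w x y (laplacian w m f)"
proof -
  let ?L = "laplacian w m"
  define D where "D = real (gdist w x y)"
  \<comment> \<open>Scaled gradient deficit:
    \<open>1 - nabla w y x f = \<delta> / D\<close>.\<close>
  define \<delta> where "\<delta> = D - (f y - f x)"
  have D: "D > 0" using gdist_pos \<open>x \<noteq> y\<close> by (simp add: D_def)
  have \<delta>: "\<delta> \<ge> 0" using Lip1D[OF f, of y x] gdist_sym[of x y] by (simp add: \<delta>_def D_def)
  obtain h where h: "h \<in> Lip1 w \<inter> Cc" "nabla w y x h = 1"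
    and near: "\<And>z. gdist w x z \<le> Suc (gdist w x y) \<Longrightarrow>
            f z - f x \<le> h z \<and> h z \<le> f z - f x + \<delta>"
    using admissible_approximation[OF f \<open>x \<noteq> y\<close>] unfolding \<delta>_def D_def by blast
  \<comment> \<open>On the relevant ball, \<open>h - (f - f x)\<close> takes values in
    \<open>[0, \<delta>]\<close>, so its increments are at most \<open>\<delta>\<close>, not
    \<open>2 * \<delta>\<close>.\<close>
  have lap: "\<bar>?L h u - ?L f u\<bar> \<le> \<delta> * Deg w m u" if u: "u = x \<or> u = y" for u
  proof (rule laplacian_diff_abs_le)
    fix v assume "adj w u v"
    then have "gdist w u v \<le> 1" by (rule gdist_adj)
    moreover have "gdist w x u \<le> gdist w x y" using u gdist_self[of x] by auto
    ultimately have "gdist w x v \<le> Suc (gdist w x y)" "gdist w x u \<le> Suc (gdist w x y)"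
      using gdist_triangle[of x v u] by linarith+
    with near[of v] near[of u] show "\<bar>(h v - h u) - (f v - f u)\<bar> \<le> \<delta>" by linarith
  qed
  have "?L h x - ?L h y \<le> ?L f x - ?L f y + \<delta> * (Deg w m x + Deg w m y)"
    using lap[of x] lap[of y] by (simp add: distrib_left)
  then have "\<epsilon> * (?L h x - ?L h y) \<le> \<epsilon> * (?L f x - ?L f y + \<delta> * (Deg w m x + Deg w m y))"
    using \<epsilon>(1) by (rule mult_left_mono)
  also have "\<dots> = \<epsilon> * (?L f x - ?L f y) + \<delta> * (\<epsilon> * (Deg w m x + Deg w m y))"
    by (simp add: algebra_simps)
  \<comment> \<open>Here the smallness of \<open>\<epsilon>\<close> enters: the total error is at
    most the deficit \<open>\<delta>\<close>.\<close>
  also have "\<dots> \<le> \<epsilon> * (?L f x - ?L f y) + \<delta>"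
    using mult_left_mono[OF \<epsilon>(2) \<delta>] by simp
  finally have "\<epsilon> * (?L h x - ?L h y) / D \<le> (\<epsilon> * (?L f x - ?L f y) + \<delta>) / D"
    using D by (intro divide_right_mono) auto
  also have "\<dots> = 1 - nabla w y x f + \<epsilon> * nabla w x y (?L f)"
    using D gdist_sym[of y x] by (simp add: nabla_def D_def[symmetric] \<delta>_def field_simps)
  finally have "\<epsilon> * nabla w x y (?L h) \<le> 1 - nabla w y x f + \<epsilon> * nabla w x y (?L f)"
    by (simp add: nabla_def D_def)
  moreover have "min_gradient x y \<le> nabla w x y (?L h)"
    using h by (intro cINF_lower admissible_bdd_below) auto
  ultimately show ?thesis using mult_left_mono[OF _ \<epsilon>(1)] by fastforce
qed

text \<open>One inequality bounds the functional of every bounded Lipschitz function by the previous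
  lemma; the other tests the supremum with negated admissible functions.\<close>

lemma kappa_eps_eq:
  assumes "x \<noteq> y" and \<epsilon>: "0 < \<epsilon>" "\<epsilon> * (Deg w m x + Deg w m y) \<le> 1"
  shows "kappa_eps w m \<epsilon> x y = \<epsilon> * min_gradient x y"
proof -
  let ?L = "laplacian w m"
  define D where "D = real (gdist w x y)"
  define W where "W = Wasserstein w (walk_measure w m \<epsilon> x) (walk_measure w m \<epsilon> y)"
  let ?S = "\<lambda>f. \<Sum>\<^sub>\<infinity>z. f z * (walk_measure w m \<epsilon> x z - walk_measure w m \<epsilon> y z)"
  have D: "D > 0" using gdist_pos \<open>x \<noteq> y\<close> by (simp add: D_def)
  \<comment> \<open>The sign flips because duality favours large values at \<open>x\<close>, while
    admissible functions increase from \<open>x\<close> to \<open>y\<close>.\<close>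
  have S: "1 - ?S (\<lambda>z. - f z) / D = 1 - nabla w y x f + \<epsilon> * nabla w x y (?L f)" for f
    unfolding infsum_walk_measure_diff laplacian_uminus
    using D gdist_sym[of y x] by (simp add: nabla_def D_def[symmetric] field_simps)
  have "W \<le> D * (1 - \<epsilon> * min_gradient x y)"
    unfolding W_def Wasserstein_def
  proof (rule cSUP_least)
    have "(\<lambda>z. 0) \<in> {f \<in> Lip1 w. bounded (range f)}" by (simp add: Lip1_def)
    then show "{f \<in> Lip1 w. bounded (range f)} \<noteq> {}" by blast
    fix f assume "f \<in> {f \<in> Lip1 w. bounded (range f)}"
    then have "(\<lambda>z. - f z) \<in> Lip1 w" by (simp add: Lip1_uminus)
    from transport_cost_lower_bound[OF this \<open>x \<noteq> y\<close> less_imp_le[OF \<epsilon>(1)] \<epsilon>(2)]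
    have "\<epsilon> * min_gradient x y \<le> 1 - ?S f / D"
      unfolding S[of "\<lambda>z. - f z", symmetric] by simp
    then show "?S f \<le> D * (1 - \<epsilon> * min_gradient x y)"
      using D by (simp add: field_simps)
  qed
  then have "\<epsilon> * min_gradient x y \<le> 1 - W / D" using D by (simp add: field_simps)
  \<comment> \<open>Dividing by \<open>\<epsilon>\<close> leaves a lower bound for each member of
    the infimum.\<close>
  moreover have "(1 - W / D) / \<epsilon> \<le> min_gradient x y"
  proof (rule cINF_greatest[OF admissible_nonempty[OF \<open>x \<noteq> y\<close>]])
    fix f assume f: "f \<in> {f \<in> Lip1 w \<inter> Cc. nabla w y x f = 1}"
    have "?S (\<lambda>z. - f z) \<le> W"
      unfolding W_def Wasserstein_def
      by (rule cSUP_upper[OF _ Wasserstein_bdd_above])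
        (use f in \<open>auto intro: Lip1_uminus Cc_bounded Cc_uminus\<close>)
    then have "1 - W / D \<le> 1 - ?S (\<lambda>z. - f z) / D" using D by (simp add: divide_right_mono)
    also have "\<dots> = \<epsilon> * nabla w x y (?L f)" using S[of f] f by simp
    finally show "(1 - W / D) / \<epsilon> \<le> nabla w x y (?L f)"
      using \<epsilon>(1) by (simp add: field_simps)
  qed
  then have "1 - W / D \<le> \<epsilon> * min_gradient x y" using \<epsilon>(1) by (simp add: pos_divide_le_eq mult.commute)
  ultimately show ?thesis by (simp add: kappa_eps_def W_def D_def)
qed

lemma kappa_eq:
  assumes "x \<noteq> y"
  shows "kappa w m x y = min_gradient x y"
proof -
  define S where "S = Deg w m x + Deg w m y"
  have S: "S \<ge> 0" by (simp add: S_def Deg_nonneg)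
  \<comment> \<open>The summand 1 makes the threshold positive given only \<open>S \<ge> 0\<close>;
    below it \<open>\<epsilon> * S \<le> 1\<close>, so the quotient is eventually constant.\<close>
  have "\<forall>\<^sub>F \<epsilon> in at_right 0. \<epsilon> < 1 / (S + 1)"
    using S eventually_at_right_less[of 0] by (auto simp: eventually_at_right_field intro!: exI[of _ "1 / (S + 1)"])
  then have "\<forall>\<^sub>F \<epsilon> in at_right 0. (1 / \<epsilon>) * kappa_eps w m \<epsilon> x y = min_gradient x y"
    using eventually_at_right_less[of 0]
  proof eventually_elim
    case (elim \<epsilon>)
    then have "\<epsilon> * S \<le> 1" using S by (simp add: field_simps)
    then show ?case using kappa_eps_eq[OF assms] elim by (simp add: S_def)
  qed
  then have "((\<lambda>\<epsilon>. (1 / \<epsilon>) * kappa_eps w m \<epsilon> x y) \<longlongrightarrow> min_gradient x y) (at_right 0)"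
    by (rule tendsto_eventually)
  then show ?thesis
    unfolding kappa_def by (intro tendsto_Lim) simp_all
qed

end

theorem theorem2p1:
  fixes w :: "'v \<Rightarrow> 'v \<Rightarrow> real" and m :: "'v \<Rightarrow> real" and x y :: 'v
  assumes "weighted_graph w m" and "x \<noteq> y"
  shows "kappa w m x y =
    (INF f\<in>{f \<in> Lip1 w \<inter> Cc. nabla w y x f = 1}. nabla w x y (laplacian w m f))"
  using weighted_graph.kappa_eq[OF assms] .

end
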